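(* Let $\mathbb{B}$ be the Bing space. For any $\theta$-discrete subsets $A,B$ of $\mathbb{B}$ and any bijection $f:A\to B$, there exists a homeomorphism $\bar f:\mathbb{B}\to\mathbb{B}$ such that $\bar f(a)=f(a)$ for all $a\in A$.
   Context: The Bing space $\mathbb{B}$ is the set $\{(x,y)\in\mathbb{Q}\times\mathbb{Q}: y\ge 0\}$ endowed with the topology consisting of all sets $U\subset\mathbb{B}$ such that for every $(a,b)\in U$ there exists $\varepsilon>0$ with $$\{(x,0)\in\mathbb{B}:|x-(a-b/\sqrt{3})|<\varepsilon\}\cup\{(x,0)\in\mathbb{B}:|x-(a+b/\sqrt{3})|<\varepsilon\}\subset U.$$ A subset $D$ of a topological space $X$ is $\theta$-discrete in $X$ if each point $x\in X$ has a neighborhood $O_x\subset X$ whose closure $\overline{O_x}$ in $X$ contains at most one point of $D$. *)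

theory Defs
  imports "HOL-Analysis.Analysis"
begin

definition bing_carrier :: "(rat \<times> rat) set" where
  "bing_carrier = {(x, y). y \<ge> 0}"

definition bing_interval :: "real \<Rightarrow> real \<Rightarrow> (rat \<times> rat) set" where
  "bing_interval c \<epsilon> = {(x, y) \<in> bing_carrier. y = 0 \<and> \<bar>real_of_rat x - c\<bar> < \<epsilon>}"

definition bing_open :: "(rat \<times> rat) set \<Rightarrow> bool" where
  "bing_open U \<longleftrightarrow> U \<subseteq> bing_carrier \<and>
     (\<forall>(a, b) \<in> U. \<exists>\<epsilon>>0.
        bing_interval (real_of_rat a - real_of_rat b / sqrt 3) \<epsilon> \<union>
        bing_interval (real_of_rat a + real_of_rat b / sqrt 3) \<epsilon> \<subseteq> U)"

definition bing_space :: "(rat \<times> rat) topology" where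
  "bing_space = topology bing_open"

lemma istopology_bing_open: "istopology bing_open"
  unfolding istopology_def
proof (intro conjI allI impI)
  fix S T
  assume S: "bing_open S" and T: "bing_open T"
  show "bing_open (S \<inter> T)"
    unfolding bing_open_def
  proof (intro conjI ballI, goal_cases)
    case 1
    show ?case using S by (auto simp: bing_open_def)
  next
    case (2 p)
    obtain a b where p: "p = (a, b)" by (cases p)
    from 2 p S obtain d where d: "d > 0"
      "bing_interval (real_of_rat a - real_of_rat b / sqrt 3) d \<union>
       bing_interval (real_of_rat a + real_of_rat b / sqrt 3) d \<subseteq> S"
      unfolding bing_open_def by blast
    from 2 p T obtain e where e: "e > 0"
      "bing_interval (real_of_rat a - real_of_rat b / sqrt 3) e \<union>
       bing_interval (real_of_rat a + real_of_rat b / sqrt 3) e \<subseteq> T"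
      unfolding bing_open_def by blast
    have "bing_interval c (min d e) \<subseteq> bing_interval c d \<inter> bing_interval c e" for c
      by (auto simp: bing_interval_def)
    with d e show ?case
      unfolding p prod.case by (intro exI[of _ "min d e"] conjI) (simp, blast)
  qed
next
  fix K
  assume K: "\<forall>S\<in>K. bing_open S"
  show "bing_open (\<Union>K)"
    unfolding bing_open_def
  proof (intro conjI ballI, goal_cases)
    case 1
    show ?case using K by (auto simp: bing_open_def)
  next
    case (2 p)
    obtain a b where p: "p = (a, b)" by (cases p)
    from 2 obtain S where S: "S \<in> K" "p \<in> S" by blast
    with K have "bing_open S" by blast
    with S p obtain d where "d > 0"
      "bing_interval (real_of_rat a - real_of_rat b / sqrt 3) d \<union>
       bing_interval (real_of_rat a + real_of_rat b / sqrt 3) d \<subseteq> S"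
      unfolding bing_open_def by blast
    with S show ?case
      unfolding p prod.case by blast
  qed
qed

lemma openin_bing_space: "openin bing_space U \<longleftrightarrow> bing_open U"
  by (simp add: bing_space_def istopology_bing_open topology_inverse')

lemma topspace_bing_space: "topspace bing_space = bing_carrier"
proof -
  have "bing_open bing_carrier"
    unfolding bing_open_def
  proof (intro conjI ballI subset_refl, goal_cases)
    case (1 p)
    have "bing_interval c 1 \<subseteq> bing_carrier" for c
      by (auto simp: bing_interval_def)
    then show ?case
      unfolding case_prod_unfold by (intro exI[of _ 1] conjI zero_less_one Un_least)
  qed
  then show ?thesis
    unfolding topspace_def openin_bing_space by (auto simp: bing_open_def)
qed

text \<open>A neighbourhood of a point is a set, not necessarily open, containing an open set
  around the point.\<close>

definition theta_discrete_in :: "'a topology \<Rightarrow> 'a set \<Rightarrow> bool" where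
  "theta_discrete_in X D \<longleftrightarrow> D \<subseteq> topspace X \<and>
     (\<forall>x \<in> topspace X. \<exists>N \<subseteq> topspace X.
        (\<exists>U. openin X U \<and> x \<in> U \<and> U \<subseteq> N) \<and>
        (\<forall>p \<in> D \<inter> (X closure_of N). \<forall>q \<in> D \<inter> (X closure_of N). p = q))"

end

theory Submission
  imports Defs
begin

text \<open>
  The topology of the Bing space only sees the two feet \<open>a \<plusminus> b / sqrt 3\<close> of a point \<open>(a, b)\<close>, and
  distinct points have disjoint feet because \<open>sqrt 3\<close> is irrational. The homeomorphism is built
  by a back-and-forth argument. A stage consists of a partial injection extending \<open>f\<close> by finitely
  many pairs and of two locally constant colourings of the set of all feet, one for the domain
  and one for the codomain, such that corresponding points have the same set of foot colours.
  Since \<open>A\<close> and \<open>B\<close> are \<open>\<theta>\<close>-discrete, their feet do not accumulate at any foot. Hence a new point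
  always finds a partner outside \<open>B\<close> with the prescribed colours (the pairs of feet are dense in
  the plane), and small neighbourhoods of the feet of a point and of its partner can be
  recoloured simultaneously without affecting the other pairs. In the limit the colour classes
  around the feet of corresponding points shrink and are matched by the bijection, which makes it
  continuous in both directions. Outside \<open>A\<close>, points of the axis are paired with points of the
  axis only; this is what the basic neighbourhoods, consisting of axis points, require.
\<close>

section \<open>Irrationality of \<open>sqrt 3\<close> and the feet of points\<close>

text \<open>In lowest terms \<open>m / n\<close>, the square of \<open>n\<close> divides that of
  \<open>m\<close>, so \<open>n\<close> is 1, and 3 is not the square of an integer.\<close>

lemma rat_square_neq_3:
  fixes q :: rat
  shows "q\<^sup>2 \<noteq> 3"
proof
  assume q: "q\<^sup>2 = 3"
  obtain m n where mn: "quotient_of q = (m, n)" by (cases "quotient_of q")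
  have n: "n > 0" using mn by (rule quotient_of_denom_pos)
  have cop: "coprime m n" using mn by (rule quotient_of_coprime)
  have "q = of_int m / of_int n" using mn by (rule quotient_of_div)
  with q n have "of_int (m\<^sup>2) = (of_int (3 * n\<^sup>2) :: rat)"
    by (simp add: power_divide field_simps)
  then have eq: "m\<^sup>2 = 3 * n\<^sup>2" by (simp only: of_int_eq_iff)
  then have "n\<^sup>2 dvd m\<^sup>2" by simp
  moreover have "coprime (m\<^sup>2) (n\<^sup>2)" using cop by simp
  ultimately have "is_unit (n\<^sup>2)"
    using coprime_absorb_right coprime_commute by blast
  then have "n\<^sup>2 = 1" using n by (simp add: zdvd1_eq)
  with eq have m3: "\<bar>m\<bar> * \<bar>m\<bar> = 3" by (simp add: power2_eq_square)
  show False
  proof (cases "\<bar>m\<bar> \<le> 1")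
    case True
    then have "\<bar>m\<bar> * \<bar>m\<bar> \<le> 1 * 1" by (intro mult_mono) auto
    with m3 show False by simp
  next
    case False
    then have "2 * 2 \<le> \<bar>m\<bar> * \<bar>m\<bar>" by (intro mult_mono) auto
    with m3 show False by simp
  qed
qed

text \<open>This is linear independence of 1 and \<open>1 / sqrt 3\<close> over the rationals; it
  allows equations between feet to be compared coefficientwise.\<close>

lemma of_rat_div_sqrt3_eq_iff:
  "real_of_rat a / sqrt 3 = real_of_rat b \<longleftrightarrow> a = 0 \<and> b = 0"
proof
  assume "real_of_rat a / sqrt 3 = real_of_rat b"
  then have eq: "real_of_rat a = real_of_rat b * sqrt 3" by (simp add: field_simps)
  have "b = 0"
  proof (rule ccontr)
    assume b: "b \<noteq> 0"
    have "real_of_rat (a\<^sup>2) = real_of_rat (3 * b\<^sup>2)"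
      by (simp add: of_rat_power of_rat_mult eq power_mult_distrib)
    then have "a\<^sup>2 = 3 * b\<^sup>2" by (simp only: of_rat_eq_iff)
    then have "(a / b)\<^sup>2 = 3" using b by (simp add: power_divide)
    then show False using rat_square_neq_3 by blast
  qed
  then show "a = 0 \<and> b = 0" using eq by simp
qed auto

text \<open>These are the points where the lines of slope \<open>sqrt 3\<close> and
  \<open>- sqrt 3\<close> through the point meet the axis. Taking an unordered set makes colour
  images comparable regardless of order and gives an axis point a single foot.\<close>

definition feet :: "rat \<times> rat \<Rightarrow> real set" where
  "feet x = {real_of_rat (fst x) - real_of_rat (snd x) / sqrt 3,
             real_of_rat (fst x) + real_of_rat (snd x) / sqrt 3}"

definition all_feet :: "real set" where
  "all_feet = \<Union> (feet ` bing_carrier)"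

lemma finite_feet [simp]: "finite (feet x)"
  and feet_not_empty [simp]: "feet x \<noteq> {}"
  by (auto simp: feet_def)

lemma feet_axis [simp]: "feet (t, 0) = {real_of_rat t}"
  by (simp add: feet_def)

lemma axis_in_carrier [simp]: "(t, 0) \<in> bing_carrier"
  by (simp add: bing_carrier_def)

lemma feet_subset_all_feet: "x \<in> bing_carrier \<Longrightarrow> feet x \<subseteq> all_feet"
  by (auto simp: all_feet_def)

lemma of_rat_in_all_feet: "real_of_rat t \<in> all_feet"
  using feet_subset_all_feet[of "(t, 0)"] by simp

lemma countable_all_feet: "countable all_feet"
  unfolding all_feet_def by (intro countable_UN countableI_type) (auto intro: countable_finite)

text \<open>A foot of \<open>(a, b)\<close> is \<open>a + s * b / sqrt 3\<close> with a sign
  \<open>s\<close>. Independence recovers \<open>a\<close> and \<open>s * b\<close>, and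
  nonnegativity of \<open>b\<close> then recovers \<open>b\<close>.\<close>

lemma feet_Int_eq_empty:
  assumes "x \<in> bing_carrier" "y \<in> bing_carrier" "x \<noteq> y"
  shows "feet x \<inter> feet y = {}"
proof (rule ccontr)
  assume "feet x \<inter> feet y \<noteq> {}"
  then obtain z where "z \<in> feet x" "z \<in> feet y" by blast
  moreover have "\<exists>s. (s = 1 \<or> s = -1) \<and>
      z = real_of_rat (fst p) + real_of_rat s * real_of_rat (snd p) / sqrt 3" if "z \<in> feet p" for p
    using that unfolding feet_def
    by (auto intro: exI[of _ 1] exI[of _ "-1"] simp: of_rat_minus)
  ultimately obtain s t where s: "s = 1 \<or> s = -1" and t: "t = 1 \<or> t = -1"
    and eq: "real_of_rat (fst x) + real_of_rat s * real_of_rat (snd x) / sqrt 3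
      = real_of_rat (fst y) + real_of_rat t * real_of_rat (snd y) / sqrt 3"
    by metis
  have "real_of_rat (s * snd x - t * snd y) / sqrt 3 = real_of_rat (fst y - fst x)"
    using eq by (simp add: of_rat_diff of_rat_mult diff_divide_distrib)
  then have "s * snd x = t * snd y" "fst x = fst y"
    by (auto simp: of_rat_div_sqrt3_eq_iff)
  moreover have "snd x \<ge> 0" "snd y \<ge> 0"
    using assms by (auto simp: bing_carrier_def)
  ultimately have "x = y" using s t by (auto simp: prod_eq_iff)
  with assms show False by simp
qed

lemma bing_open_iff:
  "bing_open U \<longleftrightarrow> U \<subseteq> bing_carrier \<and>
     (\<forall>x\<in>U. \<exists>\<epsilon>>0. \<forall>t. \<forall>z\<in>feet x. \<bar>real_of_rat t - z\<bar> < \<epsilon> \<longrightarrow> (t, 0) \<in> U)"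
proof -
  have "bing_interval (real_of_rat a - real_of_rat b / sqrt 3) \<epsilon> \<union>
        bing_interval (real_of_rat a + real_of_rat b / sqrt 3) \<epsilon> \<subseteq> U \<longleftrightarrow>
        (\<forall>t. \<forall>z\<in>feet (a, b). \<bar>real_of_rat t - z\<bar> < \<epsilon> \<longrightarrow> (t, 0) \<in> U)" for a b \<epsilon>
    unfolding feet_def bing_interval_def by auto
  then show ?thesis
    unfolding bing_open_def by (simp add: Ball_def)
qed

lemma bing_openE:
  assumes "bing_open U" "x \<in> U"
  obtains e where "e > 0" "\<And>t z. z \<in> feet x \<Longrightarrow> \<bar>real_of_rat t - z\<bar> < e \<Longrightarrow> (t, 0) \<in> U"
proof -
  from assms have "\<exists>e>0. \<forall>t. \<forall>z\<in>feet x. \<bar>real_of_rat t - z\<bar> < e \<longrightarrow> (t, 0) \<in> U"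
    by (simp add: bing_open_iff)
  then show ?thesis using that by blast
qed

section \<open>Theta-discreteness in terms of feet\<close>

text \<open>Accumulation of feet of \<open>D\<close> is excluded only at feet, not at arbitrary
  reals. The filter \<open>at z\<close> allows \<open>z\<close> itself to be a foot of
  \<open>D\<close>.\<close>

definition thin :: "(rat \<times> rat) set \<Rightarrow> bool" where
  "thin D \<longleftrightarrow> D \<subseteq> bing_carrier \<and>
     (\<forall>z\<in>all_feet. \<forall>\<^sub>F w in at z. w \<notin> \<Union> (feet ` D))"

lemma eventually_at_notin_finite:
  fixes z :: real
  assumes "finite F"
  shows "\<forall>\<^sub>F w in at z. w \<notin> F"
proof -
  have "\<forall>\<^sub>F w in at z. w \<in> - (F - {z})"
    using assms by (intro eventually_at_in_open' open_Compl finite_imp_closed) auto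
  moreover have "\<forall>\<^sub>F w in at z. w \<noteq> z"
    by (simp add: eventually_at_filter)
  ultimately show ?thesis by eventually_elim auto
qed

lemma thin_insert:
  assumes "thin D" "x \<in> bing_carrier"
  shows "thin (insert x D)"
  unfolding thin_def
proof (intro conjI ballI)
  show "insert x D \<subseteq> bing_carrier" using assms by (simp add: thin_def)
  fix z assume "z \<in> all_feet"
  with assms(1) have "\<forall>\<^sub>F w in at z. w \<notin> \<Union> (feet ` D)" by (simp add: thin_def)
  moreover have "\<forall>\<^sub>F w in at z. w \<notin> feet x" by (simp add: eventually_at_notin_finite)
  ultimately show "\<forall>\<^sub>F w in at z. w \<notin> \<Union> (feet ` insert x D)"
    by eventually_elim auto
qed

text \<open>A point of \<open>A\<close> with a foot within \<open>e\<close> of \<open>z\<close> lies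
  in the closure of \<open>N\<close>, since axis points close to that foot belong to
  \<open>U\<close>. Hence all feet of \<open>A\<close> near \<open>z\<close> come from one point and
  are finitely many.\<close>

lemma theta_discrete_imp_thin:
  assumes "theta_discrete_in bing_space A"
  shows "thin A"
  unfolding thin_def
proof (intro conjI ballI)
  show A: "A \<subseteq> bing_carrier"
    using assms by (simp add: theta_discrete_in_def topspace_bing_space)
  fix z assume "z \<in> all_feet"
  then obtain x where x: "x \<in> bing_carrier" "z \<in> feet x" by (auto simp: all_feet_def)
  have "\<forall>x\<in>bing_carrier. \<exists>N\<subseteq>bing_carrier. (\<exists>U. bing_open U \<and> x \<in> U \<and> U \<subseteq> N) \<and>
      (\<forall>p \<in> A \<inter> (bing_space closure_of N). \<forall>q \<in> A \<inter> (bing_space closure_of N). p = q)"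
    using assms unfolding theta_discrete_in_def topspace_bing_space openin_bing_space
    by (rule conjunct2)
  from bspec[OF this x(1)] obtain N U where U: "bing_open U" "x \<in> U" "U \<subseteq> N"
    and N: "\<forall>p \<in> A \<inter> (bing_space closure_of N). \<forall>q \<in> A \<inter> (bing_space closure_of N). p = q"
    by (elim exE conjE)
  from U(1,2) obtain e where e: "e > 0"
    "\<And>t w. w \<in> feet x \<Longrightarrow> \<bar>real_of_rat t - w\<bar> < e \<Longrightarrow> (t, 0) \<in> U"
    by (rule bing_openE) blast
  have clos: "a \<in> bing_space closure_of N" if "a \<in> A" "w \<in> feet a" "\<bar>w - z\<bar> < e" for a w
    unfolding in_closure_of openin_bing_space topspace_bing_space
  proof (intro conjI allI impI)
    show "a \<in> bing_carrier" using that A by auto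
    fix T assume "a \<in> T \<and> bing_open T"
    then have "bing_open T" "a \<in> T" by auto
    then obtain d where d: "d > 0"
      "\<And>t w. w \<in> feet a \<Longrightarrow> \<bar>real_of_rat t - w\<bar> < d \<Longrightarrow> (t, 0) \<in> T"
      by (rule bing_openE) blast
    \<comment> \<open>This radius keeps \<open>t\<close> within \<open>d\<close> of
      \<open>w\<close>, hence in \<open>T\<close>, and within \<open>e\<close> of \<open>z\<close>,
      hence in \<open>U\<close>.\<close>
    define r where "r = min d (e - \<bar>w - z\<bar>)"
    have "r > 0" using d that by (simp add: r_def)
    then obtain t where t: "w < real_of_rat t" "real_of_rat t < w + r"
      using of_rat_dense[of w "w + r"] by auto
    have "(t, 0) \<in> T" using t that by (intro d(2)[of w]) (auto simp: r_def)
    moreover have "(t, 0) \<in> U" using t x by (intro e(2)[of z]) (auto simp: r_def)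
    ultimately show "\<exists>y. y \<in> N \<and> y \<in> T" using U by blast
  qed
  define F where "F = {w \<in> \<Union> (feet ` A). \<bar>w - z\<bar> < e}"
  have "finite F"
  proof (cases "F = {}")
    case False
    then obtain a w where a: "a \<in> A" "w \<in> feet a" "\<bar>w - z\<bar> < e" by (auto simp: F_def)
    have "F \<subseteq> feet a"
    proof
      fix u assume "u \<in> F"
      then obtain b where b: "b \<in> A" "u \<in> feet b" "\<bar>u - z\<bar> < e" by (auto simp: F_def)
      have "b = a" using N clos[OF a] clos[OF b] a(1) b(1) by blast
      with b show "u \<in> feet a" by simp
    qed
    then show ?thesis by (rule finite_subset) simp
  qed simp
  then have "\<forall>\<^sub>F w in at z. w \<notin> F" by (rule eventually_at_notin_finite)
  moreover have "\<forall>\<^sub>F w in at z. w \<in> {z - e<..<z + e}"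
    using e by (intro eventually_at_in_open') auto
  ultimately show "\<forall>\<^sub>F w in at z. w \<notin> \<Union> (feet ` A)"
    by eventually_elim (fastforce simp: F_def abs_less_iff)
qed

section \<open>Points with feet in prescribed places\<close>

text \<open>The interval is one-sided and omits \<open>z\<close>, because \<open>z\<close> itself
  may be a foot of \<open>D\<close>.\<close>

lemma eventually_right_interval:
  fixes z :: real
  assumes "\<forall>\<^sub>F w in nhds z. P w" "thin D" "z \<in> all_feet"
  obtains d where "d > 0" "\<And>w. w \<in> {z<..<z + d} \<Longrightarrow> P w \<and> w \<notin> \<Union> (feet ` D)"
proof -
  have "\<forall>\<^sub>F w in at z. P w"
    using assms(1) by (simp add: eventually_at_filter eventually_mono)
  moreover have "\<forall>\<^sub>F w in at z. w \<notin> \<Union> (feet ` D)" using assms by (simp add: thin_def)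
  ultimately have "\<forall>\<^sub>F w in at z. P w \<and> w \<notin> \<Union> (feet ` D)" by (rule eventually_conj)
  then obtain d where "d > 0" "\<forall>w. w \<noteq> z \<and> dist w z < d \<longrightarrow> P w \<and> w \<notin> \<Union> (feet ` D)"
    unfolding eventually_at by auto
  then show ?thesis by (intro that[of d]) (auto simp: dist_real_def)
qed

lemma rational_near_foot:
  assumes "\<forall>\<^sub>F w in nhds z. P w" "thin D" "z \<in> all_feet"
  obtains t where "P (real_of_rat t)" "real_of_rat t \<notin> \<Union> (feet ` D)"
proof -
  obtain d where d: "d > 0" "\<And>w. w \<in> {z<..<z + d} \<Longrightarrow> P w \<and> w \<notin> \<Union> (feet ` D)"
    using eventually_right_interval[OF assms] by metis
  obtain t where "z < real_of_rat t" "real_of_rat t < z + d"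
    using of_rat_dense[of z "z + d"] d(1) by auto
  then show ?thesis using d(2) by (intro that[of t]) auto
qed

text \<open>The feet of \<open>(a, b)\<close> have midpoint \<open>a\<close> and half-distance
  \<open>b / sqrt 3\<close>; each is approximated up to \<open>e / 2\<close>, and
  \<open>u < v\<close> makes \<open>b\<close> positive.\<close>

lemma feet_dense_ordered:
  fixes u v :: real
  assumes "u < v" "e > 0"
  obtains p where "p \<in> bing_carrier" "snd p \<noteq> 0"
    "\<And>z. z \<in> feet p \<Longrightarrow> \<bar>z - u\<bar> < e \<or> \<bar>z - v\<bar> < e"
    "\<exists>z\<in>feet p. \<bar>z - u\<bar> < e" "\<exists>z\<in>feet p. \<bar>z - v\<bar> < e"
proof -
  obtain a where a: "(u + v) / 2 < real_of_rat a" "real_of_rat a < (u + v) / 2 + e / 2"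
    using of_rat_dense[of "(u + v) / 2" "(u + v) / 2 + e / 2"] assms by auto
  obtain b where b: "sqrt 3 * ((v - u) / 2) < real_of_rat b"
    "real_of_rat b < sqrt 3 * ((v - u) / 2 + e / 2)"
    using of_rat_dense[of "sqrt 3 * ((v - u) / 2)" "sqrt 3 * ((v - u) / 2 + e / 2)"] assms(2)
    by (metis add_strict_left_mono add.right_neutral half_gt_zero mult_strict_left_mono
        real_sqrt_gt_zero zero_less_numeral)
  define r where "r = real_of_rat b / sqrt 3"
  have r: "(v - u) / 2 < r" "r < (v - u) / 2 + e / 2"
    using b by (simp_all add: r_def field_simps)
  have "sqrt 3 * ((v - u) / 2) > 0" using assms by simp
  then have "real_of_rat b > 0" using b(1) by linarith
  then have b0: "b > 0" by simp
  have F: "feet (a, b) = {real_of_rat a - r, real_of_rat a + r}"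
    by (simp add: feet_def r_def)
  have "\<bar>real_of_rat a - r - u\<bar> < e" "\<bar>real_of_rat a + r - v\<bar> < e"
    using a r by (auto simp: abs_if field_simps)
  then show ?thesis
    using b0 F by (intro that[of "(a, b)"]) (auto simp: bing_carrier_def)
qed

lemma feet_dense:
  fixes u v :: real
  assumes "u \<noteq> v" "e > 0"
  obtains p where "p \<in> bing_carrier" "snd p \<noteq> 0"
    "\<And>z. z \<in> feet p \<Longrightarrow> \<bar>z - u\<bar> < e \<or> \<bar>z - v\<bar> < e"
    "\<exists>z\<in>feet p. \<bar>z - u\<bar> < e" "\<exists>z\<in>feet p. \<bar>z - v\<bar> < e"
proof (cases "u < v")
  case True
  then show ?thesis using feet_dense_ordered[OF True assms(2)] that by metis
next
  case False
  then have "v < u" using assms by simp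
  from feet_dense_ordered[OF this assms(2)] show ?thesis using that by metis
qed

section \<open>Locally constant colourings and isolating neighbourhoods\<close>

text \<open>A colouring may jump at reals that are not feet, so nonconstant colourings of the
  connected real line are possible.\<close>

definition locally_constant :: "(real \<Rightarrow> 'a) \<Rightarrow> bool" where
  "locally_constant c \<longleftrightarrow> (\<forall>z\<in>all_feet. \<forall>\<^sub>F w in nhds z. c w = c z)"

text \<open>Only countably many distances occur between \<open>F\<close> and the feet, while the
  interval of candidate radii is uncountable.\<close>

lemma avoid_distances:
  assumes "d > 0" "finite F"
  obtains r :: real where "0 < r" "r < d" "\<And>z w. z \<in> F \<Longrightarrow> w \<in> all_feet \<Longrightarrow> \<bar>w - z\<bar> \<noteq> r"
proof -
  let ?B = "(\<lambda>(z, w). \<bar>w - z\<bar>) ` (F \<times> all_feet)"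
  have "countable ?B"
    using assms countable_all_feet by (intro countable_image countable_SIGMA) (auto intro: countable_finite)
  moreover have "uncountable {0<..<d}" using assms by (simp add: uncountable_open_interval)
  ultimately have "\<not> {0<..<d} \<subseteq> ?B" using countable_subset by blast
  then obtain r where "r \<in> {0<..<d}" "r \<notin> ?B" by blast
  then show ?thesis by (intro that[of r]) (auto simp: image_iff)
qed

text \<open>The radius of the balls is chosen so that no foot lies on their boundary; this makes
  membership in \<open>V\<close> locally constant on the dense set of feet.\<close>

lemma isolating_neighbourhood:
  assumes "thin D" "y \<in> D" "locally_constant c" "\<delta> > 0"
  obtains V where "feet y \<subseteq> V" "\<And>x. x \<in> D \<Longrightarrow> x \<noteq> y \<Longrightarrow> feet x \<inter> V = {}"
    "\<And>w. w \<in> V \<Longrightarrow> \<exists>z\<in>feet y. \<bar>w - z\<bar> < \<delta>"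
    "c ` V \<subseteq> c ` feet y" "c ` feet y \<subseteq> c ` (all_feet - V)"
    "locally_constant (\<lambda>w. w \<in> V)"
proof -
  have y: "y \<in> bing_carrier" and feet_y: "feet y \<subseteq> all_feet"
    using assms(1,2) feet_subset_all_feet unfolding thin_def by blast+
  have lc: "\<forall>\<^sub>F w in nhds z. c w = c z" if "z \<in> feet y" for z
    using that assms(3) feet_y by (auto simp: locally_constant_def)
  \<comment> \<open>Besides isolating \<open>z\<close>, the radius \<open>d\<close> leaves room for
    a rational \<open>w\<close> of the same colour away from all feet of \<open>y\<close>. It keeps
    that colour present outside \<open>V\<close>.\<close>
  have "\<exists>d>0. (\<forall>w. \<bar>w - z\<bar> < d \<longrightarrow> c w = c z \<and> (w \<in> \<Union> (feet ` D) \<longrightarrow> w = z)) \<and>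
      (\<exists>w\<in>all_feet. c w = c z \<and> (\<forall>z'\<in>feet y. \<bar>w - z'\<bar> \<ge> d))" if z: "z \<in> feet y" for z
  proof -
    have "\<forall>\<^sub>F w in at z. w \<notin> \<Union> (feet ` D)" using assms(1) z feet_y by (auto simp: thin_def)
    then have "\<forall>\<^sub>F w in nhds z. w \<in> \<Union> (feet ` D) \<longrightarrow> w = z"
      unfolding eventually_at_filter by eventually_elim auto
    with lc[OF z] have "\<forall>\<^sub>F w in nhds z. c w = c z \<and> (w \<in> \<Union> (feet ` D) \<longrightarrow> w = z)"
      by (rule eventually_conj)
    then obtain d1 where d1: "d1 > 0"
      "\<And>w. \<bar>w - z\<bar> < d1 \<Longrightarrow> c w = c z \<and> (w \<in> \<Union> (feet ` D) \<longrightarrow> w = z)"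
      unfolding eventually_nhds_metric dist_real_def by auto
    obtain t where t: "c (real_of_rat t) = c z" "real_of_rat t \<notin> \<Union> (feet ` D)"
      using rational_near_foot[OF lc[OF z] assms(1)] z feet_y by auto
    then have t': "real_of_rat t \<notin> feet y" using assms(2) by auto
    define d2 where "d2 = Min ((\<lambda>z'. \<bar>real_of_rat t - z'\<bar>) ` feet y)"
    have d2: "d2 > 0" unfolding d2_def using t' by (subst Min_gr_iff) auto
    have "\<forall>z'\<in>feet y. \<bar>real_of_rat t - z'\<bar> \<ge> d2" unfolding d2_def by auto
    then have "\<exists>w\<in>all_feet. c w = c z \<and> (\<forall>z'\<in>feet y. \<bar>w - z'\<bar> \<ge> min d1 d2)"
      using t(1) of_rat_in_all_feet[of t] by (meson min.coboundedI2)
    moreover have "\<forall>w. \<bar>w - z\<bar> < min d1 d2 \<longrightarrow> c w = c z \<and> (w \<in> \<Union> (feet ` D) \<longrightarrow> w = z)"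
      using d1(2) by (meson min_less_iff_conj)
    moreover have "min d1 d2 > 0" using d1(1) d2 by simp
    ultimately show ?thesis by blast
  qed
  then have "\<forall>z\<in>feet y. \<exists>d>0. (\<forall>w. \<bar>w - z\<bar> < d \<longrightarrow> c w = c z \<and> (w \<in> \<Union> (feet ` D) \<longrightarrow> w = z)) \<and>
      (\<exists>w\<in>all_feet. c w = c z \<and> (\<forall>z'\<in>feet y. \<bar>w - z'\<bar> \<ge> d))" ..
  from bchoice[OF this] obtain d where
    "\<forall>z\<in>feet y. 0 < d z \<and> (\<forall>w. \<bar>w - z\<bar> < d z \<longrightarrow> c w = c z \<and> (w \<in> \<Union> (feet ` D) \<longrightarrow> w = z)) \<and>
      (\<exists>w\<in>all_feet. c w = c z \<and> (\<forall>z'\<in>feet y. \<bar>w - z'\<bar> \<ge> d z))" ..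
  then have d: "\<And>z. z \<in> feet y \<Longrightarrow> d z > 0"
    "\<And>z w. z \<in> feet y \<Longrightarrow> \<bar>w - z\<bar> < d z \<Longrightarrow> c w = c z"
    "\<And>z w. z \<in> feet y \<Longrightarrow> \<bar>w - z\<bar> < d z \<Longrightarrow> w \<in> \<Union> (feet ` D) \<Longrightarrow> w = z"
    "\<And>z. z \<in> feet y \<Longrightarrow> \<exists>w\<in>all_feet. c w = c z \<and> (\<forall>z'\<in>feet y. \<bar>w - z'\<bar> \<ge> d z)"
    by blast+
  define m where "m = Min (insert \<delta> (d ` feet y))"
  have "m > 0" unfolding m_def using d(1) assms(4) by (subst Min_gr_iff) auto
  then obtain r where r: "0 < r" "r < m"
    "\<And>z w. z \<in> feet y \<Longrightarrow> w \<in> all_feet \<Longrightarrow> \<bar>w - z\<bar> \<noteq> r"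
    using avoid_distances[of m "feet y"] by auto
  have rd: "r < d z" if "z \<in> feet y" for z
    using r(2) that unfolding m_def by (subst (asm) Min_gr_iff) auto
  have r\<delta>: "r < \<delta>" using r(2) unfolding m_def by (subst (asm) Min_gr_iff) auto
  define V where "V = {w. \<exists>z\<in>feet y. \<bar>w - z\<bar> < r}"
  show ?thesis
  proof (rule that[of V])
    show "feet y \<subseteq> V" using r(1) by (force simp: V_def)
    show "feet x \<inter> V = {}" if "x \<in> D" "x \<noteq> y" for x
    proof -
      have "x \<in> bing_carrier" using that assms(1) by (auto simp: thin_def)
      then have "feet x \<inter> feet y = {}" using that y feet_Int_eq_empty by blast
      moreover have "w \<in> feet y" if "w \<in> feet x" "w \<in> V" for w
      proof -
        obtain z where z: "z \<in> feet y" "\<bar>w - z\<bar> < r" using \<open>w \<in> V\<close> by (auto simp: V_def)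
        then have "w = z" using d(3)[OF z(1), of w] rd[OF z(1)] \<open>x \<in> D\<close> \<open>w \<in> feet x\<close> by auto
        with z show ?thesis by simp
      qed
      ultimately show ?thesis by blast
    qed
    show "\<exists>z\<in>feet y. \<bar>w - z\<bar> < \<delta>" if "w \<in> V" for w
      using that r\<delta> unfolding V_def by (auto intro: less_trans)
    show "c ` V \<subseteq> c ` feet y"
    proof (intro image_subsetI)
      fix w assume "w \<in> V"
      then obtain z where z: "z \<in> feet y" "\<bar>w - z\<bar> < r" by (auto simp: V_def)
      then have "c w = c z" using rd[OF z(1)] by (intro d(2)) auto
      then show "c w \<in> c ` feet y" using z by simp
    qed
    show "c ` feet y \<subseteq> c ` (all_feet - V)"
    proof
      fix i assume "i \<in> c ` feet y"
      then obtain z where z: "z \<in> feet y" "i = c z" by auto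
      from d(4)[OF z(1)] obtain w where w: "w \<in> all_feet" "c w = c z" "\<forall>z'\<in>feet y. \<bar>w - z'\<bar> \<ge> d z"
        by blast
      then have "w \<notin> V" using rd[OF z(1)] unfolding V_def by fastforce
      then show "i \<in> c ` (all_feet - V)" using w z by (metis DiffI imageI)
    qed
    show "locally_constant (\<lambda>w. w \<in> V)"
      unfolding locally_constant_def
    proof
      fix w assume w: "w \<in> all_feet"
      have V_ball: "V = (\<Union>z\<in>feet y. ball z r)"
        by (auto simp: V_def dist_real_def abs_minus_commute)
      show "\<forall>\<^sub>F u in nhds w. (u \<in> V) = (w \<in> V)"
      proof (cases "w \<in> V")
        case True
        have "open V" unfolding V_ball by auto
        from eventually_nhds_in_open[OF this True] show ?thesis
          by eventually_elim (simp add: True)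
      next
        case False
        let ?C = "\<Union>z\<in>feet y. cball z r"
        have "closed ?C" by (intro closed_UN) auto
        then have "open (- ?C)" by (rule open_Compl)
        moreover have "w \<in> - ?C"
        proof
          assume "w \<in> ?C"
          then obtain z where z: "z \<in> feet y" "\<bar>w - z\<bar> \<le> r"
            by (auto simp: dist_real_def abs_minus_commute)
          moreover have "\<bar>w - z\<bar> \<noteq> r" using r(3) z(1) w by blast
          ultimately show False using False by (auto simp: V_def)
        qed
        ultimately have "\<forall>\<^sub>F u in nhds w. u \<in> - ?C" by (rule eventually_nhds_in_open)
        then show ?thesis
        proof eventually_elim
          case (elim u)
          have "ball z r \<subseteq> cball z r" for z by (rule ball_subset_cball)
          with elim have "u \<notin> V" unfolding V_ball by blast
          with False show ?case by simp
        qed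
      qed
    qed
  qed
qed

section \<open>Stages and their extension by one point\<close>

text \<open>A stage of the back-and-forth construction: \<open>S\<close> is the graph of a partial injection
  extending \<open>f\<close>, whose graph is \<open>G\<close>, and \<open>c\<close>, \<open>c'\<close> colour the feet in the domain and in the
  codomain, respectively, so that corresponding points have feet of the same colours.\<close>

definition stage where
  "stage G S c c' \<longleftrightarrow>
     thin (Domain S) \<and> thin (Range S) \<and> single_valued S \<and> single_valued (S\<inverse>) \<and>
     locally_constant c \<and> locally_constant c' \<and> c ` all_feet = c' ` all_feet \<and>
     (\<forall>(x, y)\<in>S. c ` feet x = c' ` feet y \<and> ((x, y) \<in> G \<or> (snd x = 0 \<longleftrightarrow> snd y = 0)))"

lemma stage_colours: "stage G S c c' \<Longrightarrow> (x, y) \<in> S \<Longrightarrow> c ` feet x = c' ` feet y"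
  and stage_axis:
    "stage G S c c' \<Longrightarrow> (x, y) \<in> S \<Longrightarrow> (x, y) \<in> G \<or> (snd x = 0 \<longleftrightarrow> snd y = 0)"
  unfolding stage_def by blast+

text \<open>By this symmetry the back step is the forth step applied to the converse
  relation.\<close>

lemma stage_converse: "stage G S c c' \<Longrightarrow> stage (G\<inverse>) (S\<inverse>) c' c"
  unfolding stage_def by fastforce

text \<open>The colours at the feet of \<open>x\<close> also occur in the codomain, where they
  persist on small intervals that avoid the feet of \<open>Range S\<close>. Density supplies a point
  with feet in these intervals, so the colourings need not change.\<close>

lemma stage_extend_domain:
  assumes "stage G S c c'" "x \<in> bing_carrier"
  shows "\<exists>y. stage G (insert (x, y) S) c c'"
proof (cases "x \<in> Domain S")
  case True
  then obtain y where "(x, y) \<in> S" by auto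
  then show ?thesis using assms(1) by (intro exI[of _ y]) (simp add: insert_absorb)
next
  case False
  have S: "thin (Domain S)" "thin (Range S)" "single_valued S" "single_valued (S\<inverse>)"
    "locally_constant c" "locally_constant c'" "c ` all_feet = c' ` all_feet"
    using assms(1) by (auto simp: stage_def)
  have colour: "\<exists>z\<in>all_feet. c' z = c w" if "w \<in> all_feet" for w
    using S(7) that by (metis imageE imageI)
  have lc': "\<forall>\<^sub>F w in nhds z. c' w = c' z" if "z \<in> all_feet" for z
    using that S(6) by (simp add: locally_constant_def)
  have "\<exists>y. y \<in> bing_carrier \<and> y \<notin> Range S \<and> c ` feet x = c' ` feet y \<and> (snd x = 0 \<longleftrightarrow> snd y = 0)"
  proof (cases "snd x = 0")
    case True
    then have x: "feet x = {real_of_rat (fst x)}" by (simp add: feet_def)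
    obtain z where z: "z \<in> all_feet" "c' z = c (real_of_rat (fst x))"
      using colour of_rat_in_all_feet by blast
    obtain t where t: "c' (real_of_rat t) = c' z" "real_of_rat t \<notin> \<Union> (feet ` Range S)"
      using rational_near_foot[OF lc'[OF z(1)] S(2) z(1)] by auto
    have "(t, 0) \<notin> Range S"
    proof
      assume "(t, 0) \<in> Range S"
      then have "real_of_rat t \<in> \<Union> (feet ` Range S)" by (rule UN_I) simp
      with t(2) show False ..
    qed
    then show ?thesis
      using x z t(1) True by (intro exI[of _ "(t, 0)"]) simp
  next
    case False
    obtain p q where pq: "feet x = {p, q}" by (auto simp: feet_def)
    then have "p \<in> all_feet" "q \<in> all_feet"
      using feet_subset_all_feet[OF assms(2)] by simp_all
    then obtain z z' where z: "z \<in> all_feet" "c' z = c p" and z': "z' \<in> all_feet" "c' z' = c q"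
      using colour by metis
    obtain d where d: "d > 0" "\<And>w. w \<in> {z<..<z + d} \<Longrightarrow> c' w = c' z \<and> w \<notin> \<Union> (feet ` Range S)"
      using eventually_right_interval[OF lc'[OF z(1)] S(2) z(1)] by metis
    obtain d' where d': "d' > 0"
      "\<And>w. w \<in> {z'<..<z' + d'} \<Longrightarrow> c' w = c' z' \<and> w \<notin> \<Union> (feet ` Range S)"
      using eventually_right_interval[OF lc'[OF z'(1)] S(2) z'(1)] by metis
    \<comment> \<open>The factor 4 makes the \<open>e\<close>-balls around \<open>u\<close> and
      \<open>v\<close> fit into the intervals to the right of \<open>z\<close> and
      \<open>z'\<close>.\<close>
    define e where "e = min d d' / 4"
    have e: "e > 0" "4 * e \<le> d" "4 * e \<le> d'" using d d' by (auto simp: e_def)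
    define u where "u = z + 2 * e"
    \<comment> \<open>The shift keeps \<open>v\<close> distinct from \<open>u\<close>, as density of
      pairs of feet demands; the two would coincide if \<open>z = z'\<close>.\<close>
    define v where "v = (if z' + 2 * e = u then z' + e else z' + 2 * e)"
    have "u \<noteq> v" using e by (auto simp: v_def)
    then obtain y where y: "y \<in> bing_carrier" "snd y \<noteq> 0"
      "\<And>z. z \<in> feet y \<Longrightarrow> \<bar>z - u\<bar> < e \<or> \<bar>z - v\<bar> < e"
      "\<exists>z\<in>feet y. \<bar>z - u\<bar> < e" "\<exists>z\<in>feet y. \<bar>z - v\<bar> < e"
      using feet_dense[of u v e] e by metis
    have U: "c' w = c p \<and> w \<notin> \<Union> (feet ` Range S)" if "\<bar>w - u\<bar> < e" for w
    proof -
      have "w \<in> {z<..<z + d}" using that e by (auto simp: u_def abs_less_iff)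
      then show ?thesis using d(2) z by metis
    qed
    have V: "c' w = c q \<and> w \<notin> \<Union> (feet ` Range S)" if "\<bar>w - v\<bar> < e" for w
    proof -
      have "w \<in> {z'<..<z' + d'}" using that e by (auto simp: v_def abs_less_iff split: if_splits)
      then show ?thesis using d'(2) z' by metis
    qed
    have "y \<notin> Range S" using y(4) U by blast
    moreover have "c' ` feet y = {c p, c q}"
    proof
      show "c' ` feet y \<subseteq> {c p, c q}" using y(3) U V by blast
      show "{c p, c q} \<subseteq> c' ` feet y" using y(4,5) U V by (metis empty_subsetI imageI insert_subset)
    qed
    ultimately show ?thesis using y pq False by (intro exI[of _ y]) simp
  qed
  then obtain y where y: "y \<in> bing_carrier" "y \<notin> Range S" "c ` feet x = c' ` feet y"
    "snd x = 0 \<longleftrightarrow> snd y = 0" by blast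
  have "thin (Domain (insert (x, y) S))" "thin (Range (insert (x, y) S))"
    using S y(1) assms(2) by (simp_all add: thin_insert)
  moreover have "single_valued (insert (x, y) S)" "single_valued ((insert (x, y) S)\<inverse>)"
    using S(3,4) False y(2) by (auto simp: single_valued_def)
  ultimately have "stage G (insert (x, y) S) c c'"
    using assms(1) y unfolding stage_def by auto
  then show ?thesis ..
qed

section \<open>Refining the colourings at a pair\<close>

text \<open>Both colourings are coarsened by the same map \<open>\<rho>\<close>, so whatever an earlier stage
  says about the colours of a pair is preserved when the pair is added later.\<close>

definition refines :: "(real \<Rightarrow> 'a) \<Rightarrow> (real \<Rightarrow> 'a) \<Rightarrow> (real \<Rightarrow> 'a) \<Rightarrow> (real \<Rightarrow> 'a) \<Rightarrow> bool" where
  "refines c c' d d' \<longleftrightarrow> (\<exists>\<rho>. c = \<rho> \<circ> d \<and> c' = \<rho> \<circ> d')"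

lemma refines_refl: "refines c c' c c'"
  unfolding refines_def by (intro exI[of _ id]) simp

lemma refines_trans: "refines c c' d d' \<Longrightarrow> refines d d' e e' \<Longrightarrow> refines c c' e e'"
  unfolding refines_def by (metis comp_assoc)

text \<open>Sharing a colour with a foot of \<open>x\<close> thus forces closeness to a foot of
  \<open>x\<close>; this turns agreement of colours into continuity.\<close>

definition fine_at :: "real \<Rightarrow> (real \<Rightarrow> 'a) \<Rightarrow> rat \<times> rat \<Rightarrow> bool" where
  "fine_at \<delta> c x \<longleftrightarrow> (\<forall>w. c w \<in> c ` feet x \<longrightarrow> (\<exists>z\<in>feet x. \<bar>w - z\<bar> < \<delta>))"

text \<open>The old colour and the membership bit are packed into one natural number; halving
  recovers the old colour.\<close>

definition split_colour :: "real set \<Rightarrow> (real \<Rightarrow> nat) \<Rightarrow> real \<Rightarrow> nat" where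
  "split_colour V c w = 2 * c w + of_bool (w \<in> V)"

lemma split_colour_eq_iff:
  "split_colour V c w = split_colour V' c' w' \<longleftrightarrow> c w = c' w' \<and> (w \<in> V \<longleftrightarrow> w' \<in> V')"
  unfolding split_colour_def by (cases "w \<in> V"; cases "w' \<in> V'") (auto, presburger+)

text \<open>Both colourings are split along isolating neighbourhoods of the feet of \<open>x\<close>
  and of \<open>y\<close>. Among the pairs of \<open>S\<close>, only \<open>(x, y)\<close> receives
  odd colours; all others receive doubled old ones, so matching colours are preserved.\<close>

lemma stage_refine:
  assumes "stage G S c c'" "(x, y) \<in> S" "\<delta> > 0"
  obtains d d' :: "real \<Rightarrow> nat" where "stage G S d d'" "refines c c' d d'"
    "fine_at \<delta> d x" "fine_at \<delta> d' y"
proof -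
  have S: "thin (Domain S)" "thin (Range S)" "single_valued S" "single_valued (S\<inverse>)"
    "locally_constant c" "locally_constant c'" "c ` all_feet = c' ` all_feet"
    "\<And>p q. (p, q) \<in> S \<Longrightarrow> c ` feet p = c' ` feet q"
    "\<And>p q. (p, q) \<in> S \<Longrightarrow> (p, q) \<in> G \<or> (snd p = 0 \<longleftrightarrow> snd q = 0)"
    using assms(1) unfolding stage_def by (simp, simp, simp, simp, simp, simp, simp, blast, blast)
  have xy: "x \<in> Domain S" "y \<in> Range S" using assms(2) by auto
  obtain V where V: "feet x \<subseteq> V" "\<And>p. p \<in> Domain S \<Longrightarrow> p \<noteq> x \<Longrightarrow> feet p \<inter> V = {}"
    "\<And>w. w \<in> V \<Longrightarrow> \<exists>z\<in>feet x. \<bar>w - z\<bar> < \<delta>"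
    "c ` V \<subseteq> c ` feet x" "c ` feet x \<subseteq> c ` (all_feet - V)"
    "locally_constant (\<lambda>w. w \<in> V)"
    using isolating_neighbourhood[OF S(1) xy(1) S(5) assms(3)] by blast
  obtain V' where V': "feet y \<subseteq> V'" "\<And>p. p \<in> Range S \<Longrightarrow> p \<noteq> y \<Longrightarrow> feet p \<inter> V' = {}"
    "\<And>w. w \<in> V' \<Longrightarrow> \<exists>z\<in>feet y. \<bar>w - z\<bar> < \<delta>"
    "c' ` V' \<subseteq> c' ` feet y" "c' ` feet y \<subseteq> c' ` (all_feet - V')"
    "locally_constant (\<lambda>w. w \<in> V')"
    using isolating_neighbourhood[OF S(2) xy(2) S(6) assms(3)] by blast
  let ?d = "split_colour V c" and ?d' = "split_colour V' c'"
  have lc: "locally_constant (split_colour W k)"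
    if "locally_constant k" "locally_constant (\<lambda>w. w \<in> W)" for W k
    unfolding locally_constant_def
  proof
    fix z assume "z \<in> all_feet"
    with that have "\<forall>\<^sub>F w in nhds z. k w = k z" "\<forall>\<^sub>F w in nhds z. (w \<in> W) = (z \<in> W)"
      by (auto simp: locally_constant_def)
    then show "\<forall>\<^sub>F w in nhds z. split_colour W k w = split_colour W k z"
      by eventually_elim (simp add: split_colour_def)
  qed
  have inside: "split_colour W k ` E = (\<lambda>i. 2 * i + 1) ` k ` E" if "E \<subseteq> W" for W E k
    using that unfolding image_image by (intro image_cong) (auto simp: split_colour_def)
  have outside: "split_colour W k ` E = (\<lambda>i. 2 * i) ` k ` E" if "E \<inter> W = {}" for W E k
    using that unfolding image_image by (intro image_cong) (auto simp: split_colour_def)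
  \<comment> \<open>Every old colour survives outside \<open>W\<close>, hence as an even colour, and
    the odd colours come exactly from \<open>F\<close>. So the new palette depends only on the old
    one and on the colours of \<open>F\<close>.\<close>
  have image: "split_colour W k ` all_feet = (\<lambda>i. 2 * i) ` k ` all_feet \<union> (\<lambda>i. 2 * i + 1) ` k ` F"
    if W: "F \<subseteq> W" "F \<subseteq> all_feet" "k ` W \<subseteq> k ` F" "k ` F \<subseteq> k ` (all_feet - W)" for W k F
  proof -
    have "k ` (all_feet - W) = k ` all_feet" using W(3,4) by blast
    moreover have "k ` (all_feet \<inter> W) = k ` F" using W(1-3) by blast
    moreover have "split_colour W k ` all_feet =
        split_colour W k ` (all_feet - W) \<union> split_colour W k ` (all_feet \<inter> W)" by blast
    ultimately show ?thesis using outside[of "all_feet - W" W k] inside[of "all_feet \<inter> W" W k] by auto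
  qed
  have feet_xy: "feet x \<subseteq> all_feet" "feet y \<subseteq> all_feet"
    using xy S(1,2) feet_subset_all_feet unfolding thin_def by blast+
  have all: "?d ` all_feet = ?d' ` all_feet"
    unfolding image[OF V(1) feet_xy(1) V(4,5)] image[OF V'(1) feet_xy(2) V'(4,5)]
    using S(7) S(8)[OF assms(2)] by simp
  have "?d ` feet p = ?d' ` feet q" if "(p, q) \<in> S" for p q
  proof (cases "p = x")
    case True
    then have "q = y" using that assms(2) S(3) by (auto dest: single_valuedD)
    then show ?thesis using True inside V(1) V'(1) S(8)[OF that] by simp
  next
    case False
    then have "q \<noteq> y" using that assms(2) S(4) by (auto dest: single_valuedD)
    then have "feet p \<inter> V = {}" "feet q \<inter> V' = {}"
      using that False V(2)[of p] V'(2)[of q] by auto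
    then show ?thesis using outside S(8)[OF that] by simp
  qed
  then have "\<forall>(p, q)\<in>S. ?d ` feet p = ?d' ` feet q \<and> ((p, q) \<in> G \<or> (snd p = 0 \<longleftrightarrow> snd q = 0))"
    using S(9) by blast
  then have "stage G S ?d ?d'"
    using all S(1-4) lc[OF S(5) V(6)] lc[OF S(6) V'(6)] unfolding stage_def by blast
  moreover have "refines c c' ?d ?d'"
    unfolding refines_def
    by (intro exI[of _ "\<lambda>i. i div 2"]) (auto simp: split_colour_def fun_eq_iff)
  \<comment> \<open>The feet now carry odd colours, which occur only inside \<open>V\<close> and
    \<open>V'\<close>.\<close>
  moreover have "fine_at \<delta> ?d x" "fine_at \<delta> ?d' y"
    using V(1,3) V'(1,3) by (auto simp: fine_at_def split_colour_eq_iff)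
  ultimately show ?thesis by (rule that)
qed

text \<open>The point \<open>p\<close> is first given an image, then a preimage through the converse
  stage, and finally the colours are refined at \<open>p\<close> and its image.\<close>

lemma stage_step:
  assumes "stage G S c c'" "p \<in> bing_carrier" "\<delta> > 0"
  shows "\<exists>S' d d'. stage G S' d d' \<and> S \<subseteq> S' \<and> refines c c' d d' \<and> p \<in> Range S' \<and>
    (\<exists>q. (p, q) \<in> S' \<and> fine_at \<delta> d p \<and> fine_at \<delta> (d' :: real \<Rightarrow> nat) q)"
proof -
  obtain q where "stage G (insert (p, q) S) c c'"
    using stage_extend_domain[OF assms(1,2)] by blast
  from stage_extend_domain[OF stage_converse[OF this] assms(2)] obtain r
    where "stage (G\<inverse>) (insert (p, r) ((insert (p, q) S)\<inverse>)) c' c" by blast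
  moreover have "(insert (p, r) ((insert (p, q) S)\<inverse>))\<inverse> = insert (r, p) (insert (p, q) S)"
    by auto
  ultimately have st: "stage G (insert (r, p) (insert (p, q) S)) c c'"
    using stage_converse by fastforce
  obtain d d' where "stage G (insert (r, p) (insert (p, q) S)) d d'" "refines c c' d d'"
    "fine_at \<delta> d p" "fine_at \<delta> d' q"
    using stage_refine[OF st _ assms(3), of p q] by auto
  then show ?thesis
    by blast
qed

section \<open>Continuity from matching colourings\<close>

text \<open>An axis point near a foot of \<open>x\<close> has the colour of that foot, so the feet
  of its image are close to feet of \<open>h x\<close>. If the image is on the axis, openness of
  \<open>U\<close> applies; if it is in \<open>B\<close>, thinness makes the nearby feet coincide
  and the image equals \<open>h x\<close>.\<close>

lemma continuous_map_bing:
  fixes h :: "rat \<times> rat \<Rightarrow> rat \<times> rat"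
  assumes h: "\<And>x. x \<in> bing_carrier \<Longrightarrow> h x \<in> bing_carrier"
    and B: "thin B"
    and axis: "\<And>t. snd (h (t, 0)) = 0 \<or> h (t, 0) \<in> B"
    and fine: "\<And>x \<delta>. x \<in> bing_carrier \<Longrightarrow> \<delta> > 0 \<Longrightarrow> \<exists>c c'. locally_constant c \<and>
      (\<forall>y\<in>bing_carrier. c ` feet y = c' ` feet (h y)) \<and> fine_at \<delta> (c' :: real \<Rightarrow> 'a) (h x)"
  shows "continuous_map bing_space bing_space h"
  unfolding continuous_map_def topspace_bing_space openin_bing_space
proof (intro conjI allI impI)
  show "h \<in> bing_carrier \<rightarrow> bing_carrier" using h by auto
  fix U assume U: "bing_open U"
  show "bing_open {x \<in> bing_carrier. h x \<in> U}"
    unfolding bing_open_iff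
  proof (intro conjI ballI)
    fix x assume "x \<in> {x \<in> bing_carrier. h x \<in> U}"
    then have x: "x \<in> bing_carrier" "h x \<in> U" by auto
    from U x(2) obtain e where e: "e > 0"
      "\<And>t w. w \<in> feet (h x) \<Longrightarrow> \<bar>real_of_rat t - w\<bar> < e \<Longrightarrow> (t, 0) \<in> U"
      by (rule bing_openE) blast
    \<comment> \<open>Off-axis images cannot be caught by the axis intervals in \<open>U\<close>;
      this radius handles those lying in \<open>B\<close>.\<close>
    have "\<exists>r>0. \<forall>w\<in>\<Union> (feet ` B). \<bar>w - z\<bar> < r \<longrightarrow> w = z" if "z \<in> feet (h x)" for z
    proof -
      have "z \<in> all_feet" using that h[OF x(1)] feet_subset_all_feet by blast
      then have "\<forall>\<^sub>F w in at z. w \<notin> \<Union> (feet ` B)" using B by (simp add: thin_def)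
      then show ?thesis unfolding eventually_at dist_real_def by blast
    qed
    then obtain r where r: "\<And>z. z \<in> feet (h x) \<Longrightarrow> r z > 0"
      "\<And>z w. z \<in> feet (h x) \<Longrightarrow> w \<in> \<Union> (feet ` B) \<Longrightarrow> \<bar>w - z\<bar> < r z \<Longrightarrow> w = z"
      by metis
    define \<delta> where "\<delta> = Min (insert e (r ` feet (h x)))"
    have "\<delta> > 0" unfolding \<delta>_def using r(1) e(1) by (subst Min_gr_iff) auto
    have \<delta>: "\<delta> \<le> e" "\<And>z. z \<in> feet (h x) \<Longrightarrow> \<delta> \<le> r z" unfolding \<delta>_def by (intro Min_le; simp)+
    from fine[OF x(1) \<open>\<delta> > 0\<close>] obtain c and c' :: "real \<Rightarrow> 'a" where "locally_constant c \<and>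
      (\<forall>y\<in>bing_carrier. c ` feet y = c' ` feet (h y)) \<and> fine_at \<delta> c' (h x)" by (elim exE)
    then have c: "locally_constant c"
      "\<And>y. y \<in> bing_carrier \<Longrightarrow> c ` feet y = c' ` feet (h y)" "fine_at \<delta> c' (h x)"
      by simp_all
    have "\<exists>s>0. \<forall>w. \<bar>w - z\<bar> < s \<longrightarrow> c w = c z" if "z \<in> feet x" for z
    proof -
      have "z \<in> all_feet" using that x(1) feet_subset_all_feet by blast
      then show ?thesis
        using c(1) by (auto simp: locally_constant_def eventually_nhds_metric dist_real_def)
    qed
    then obtain s where s: "\<And>z. z \<in> feet x \<Longrightarrow> s z > 0"
      "\<And>z w. z \<in> feet x \<Longrightarrow> \<bar>w - z\<bar> < s z \<Longrightarrow> c w = c z"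
      by metis
    define \<epsilon> where "\<epsilon> = Min (s ` feet x)"
    have "\<epsilon> > 0" unfolding \<epsilon>_def using s(1) by (subst Min_gr_iff) auto
    have \<epsilon>: "\<And>z. z \<in> feet x \<Longrightarrow> \<epsilon> \<le> s z" unfolding \<epsilon>_def by auto
    have "h (t, 0) \<in> U" if z: "z \<in> feet x" "\<bar>real_of_rat t - z\<bar> < \<epsilon>" for t z
    proof -
      have "c (real_of_rat t) = c z" using z \<epsilon>[OF z(1)] by (intro s(2)) auto
      then have "c' ` feet (h (t, 0)) \<subseteq> c' ` feet (h x)"
        using c(2)[of "(t, 0)"] c(2)[OF x(1)] z(1) by auto
      then have near: "\<exists>z\<in>feet (h x). \<bar>w - z\<bar> < \<delta>" if "w \<in> feet (h (t, 0))" for w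
        using that c(3) unfolding fine_at_def by blast
      from axis[of t] show ?thesis
      proof
        assume "snd (h (t, 0)) = 0"
        then obtain q where q: "h (t, 0) = (q, 0)" by (metis prod.collapse)
        with near obtain z' where z': "z' \<in> feet (h x)" "\<bar>real_of_rat q - z'\<bar> < \<delta>" by auto
        then show ?thesis using e(2)[of z' q] \<delta>(1) q by simp
      next
        assume hB: "h (t, 0) \<in> B"
        obtain w where w: "w \<in> feet (h (t, 0))" using feet_not_empty by blast
        then obtain z' where z': "z' \<in> feet (h x)" "\<bar>w - z'\<bar> < \<delta>" using near by blast
        then have "w = z'" using w hB \<delta>(2)[OF z'(1)] by (intro r(2)) auto
        then have "h (t, 0) = h x"
          using w z'(1) feet_Int_eq_empty h x(1) axis_in_carrier by blast
        then show ?thesis using x by simp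
      qed
    qed
    then show "\<exists>\<epsilon>>0. \<forall>t. \<forall>z\<in>feet x. \<bar>real_of_rat t - z\<bar> < \<epsilon> \<longrightarrow>
        (t, 0) \<in> {x \<in> bing_carrier. h x \<in> U}"
      using \<open>\<epsilon> > 0\<close> by auto
  qed auto
qed

section \<open>The back-and-forth sequence and its limit\<close>

theorem theorem1:
  fixes A B :: "(rat \<times> rat) set" and f :: "rat \<times> rat \<Rightarrow> rat \<times> rat"
  assumes "theta_discrete_in bing_space A"
    and "theta_discrete_in bing_space B"
    and "bij_betw f A B"
  shows "\<exists>g. homeomorphic_map bing_space bing_space g \<and> (\<forall>a\<in>A. g a = f a)"
proof -
  have A: "thin A" and B: "thin B"
    using assms theta_discrete_imp_thin by auto
  define G where "G = (\<lambda>a. (a, f a)) ` A"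
  have fAB: "f ` A = B" and inj: "inj_on f A"
    using assms(3) by (auto simp: bij_betw_def)
  have DG: "Domain G = A" and RG: "Range G = B" using fAB by (force simp: G_def)+
  \<comment> \<open>Each point is paired with each precision index \<open>m\<close>, so every point
    is eventually treated with tolerance \<open>1 / (m + 1)\<close>.\<close>
  define task :: "nat \<Rightarrow> (rat \<times> rat) \<times> nat" where
    "task = from_nat_into (bing_carrier \<times> UNIV)"
  have ne: "bing_carrier \<times> (UNIV :: nat set) \<noteq> {}" using axis_in_carrier by blast
  have task: "range task = bing_carrier \<times> UNIV"
    unfolding task_def using ne by (intro range_from_nat_into) auto
  have fst_task: "fst (task n) \<in> bing_carrier" for n using task by (metis mem_Sigma_iff prod.collapse rangeI)
  let ?st = "\<lambda>(S, c, c'). stage G S c c'"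
  let ?next = "\<lambda>n (S, c, c') (S', d, d'). S \<subseteq> S' \<and> refines c c' d d' \<and> fst (task n) \<in> Range S' \<and>
    (\<exists>q. (fst (task n), q) \<in> S' \<and> fine_at (inverse (real (Suc (snd (task n))))) d (fst (task n)) \<and>
      fine_at (inverse (real (Suc (snd (task n))))) (d' :: real \<Rightarrow> nat) q)"
  \<comment> \<open>One colour suffices at the start, and the axis condition holds because every
    pair is in \<open>G\<close>.\<close>
  have init: "?st (G, \<lambda>_. 0, \<lambda>_. 0 :: nat)"
    unfolding stage_def prod.case DG RG
  proof (intro conjI)
    show "single_valued G"
      unfolding G_def by (blast intro: single_valuedI)
    show "single_valued (G\<inverse>)"
      using inj by (auto simp: single_valued_def G_def dest: inj_onD)
  qed (use A B in \<open>auto simp: locally_constant_def image_constant_conv\<close>)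
  have "\<exists>F. F 0 = (G, \<lambda>_. 0, \<lambda>_. 0 :: nat) \<and> (\<forall>n. ?st (F n)) \<and> (\<forall>n. ?next n (F n) (F (Suc n)))"
  proof -
    \<comment> \<open>The clause for \<open>n = 0\<close> pins the initial stage, which dependent
      choice alone would leave arbitrary.\<close>
    have "\<exists>F. \<forall>n. ((n = 0 \<longrightarrow> F n = (G, \<lambda>_. 0, \<lambda>_. 0 :: nat)) \<and> ?st (F n)) \<and> ?next n (F n) (F (Suc n))"
    proof (intro dependent_nat_choice)
      show "\<exists>T. (0 = (0 :: nat) \<longrightarrow> T = (G, \<lambda>_. 0, \<lambda>_. 0 :: nat)) \<and> ?st T" using init by blast
      fix T :: "((rat \<times> rat) \<times> rat \<times> rat) set \<times> (real \<Rightarrow> nat) \<times> (real \<Rightarrow> nat)" and n :: nat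
      assume T: "(n = 0 \<longrightarrow> T = (G, \<lambda>_. 0, \<lambda>_. 0)) \<and> ?st T"
      obtain S c c' where Tc: "T = (S, c, c')" by (cases T)
      with T have "stage G S c c'" by simp
      then have "\<exists>S' d d'. stage G S' d d' \<and> ?next n T (S', d, d')"
        unfolding Tc prod.case by (rule stage_step[OF _ fst_task]) simp
      then obtain S' d d' where "stage G S' d d'" "?next n T (S', d, d')" by (elim exE conjE)
      then show "\<exists>T'. ((Suc n = 0 \<longrightarrow> T' = (G, \<lambda>_. 0, \<lambda>_. 0)) \<and> ?st T') \<and> ?next n T T'"
        by (intro exI[of _ "(S', d, d')"]) simp
    qed
    then obtain F where F: "\<forall>n. ((n = 0 \<longrightarrow> F n = (G, \<lambda>_. 0, \<lambda>_. 0 :: nat)) \<and> ?st (F n)) \<and>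
      ?next n (F n) (F (Suc n))" by (elim exE)
    show ?thesis
    proof (intro exI[of _ F] conjI allI)
      show "F 0 = (G, \<lambda>_. 0, \<lambda>_. 0 :: nat)"
        using spec[OF F, of 0, THEN conjunct1, THEN conjunct1] by (rule mp) simp
      show "?st (F n)" for n by (rule spec[OF F, of n, THEN conjunct1, THEN conjunct2])
      show "?next n (F n) (F (Suc n))" for n by (rule spec[OF F, of n, THEN conjunct2])
    qed
  qed
  then obtain F where F: "F 0 = (G, \<lambda>_. 0, \<lambda>_. 0 :: nat)" "\<forall>n. ?st (F n)"
    "\<forall>n. ?next n (F n) (F (Suc n))" by (elim exE conjE)
  define S where "S n = fst (F n)" for n
  define c where "c n = fst (snd (F n))" for n
  define c' where "c' n = snd (snd (F n))" for n
  have Fn: "F n = (S n, c n, c' n)" for n by (simp add: S_def c_def c'_def)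
  have st: "stage G (S n) (c n) (c' n)" for n using F(2)[rule_format, of n] by (simp add: Fn)
  have S0: "S 0 = G" using F(1) by (simp add: S_def)
  have S_Suc: "S n \<subseteq> S (Suc n)" and ref_Suc: "refines (c n) (c' n) (c (Suc n)) (c' (Suc n))"
    and ran: "fst (task n) \<in> Range (S (Suc n))" for n
    using F(3)[rule_format, of n] by (simp_all add: Fn)
  have fine_Suc: "\<exists>q. (fst (task n), q) \<in> S (Suc n) \<and>
      fine_at (inverse (real (Suc (snd (task n))))) (c (Suc n)) (fst (task n)) \<and>
      fine_at (inverse (real (Suc (snd (task n))))) (c' (Suc n)) q" for n
    using F(3)[rule_format, of n] by (simp only: Fn prod.case)
  have S_mono: "S m \<subseteq> S n" if "m \<le> n" for m n
    using that S_Suc by (rule lift_Suc_mono_le[rotated])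
  have ref: "refines (c m) (c' m) (c n) (c' n)" if "m \<le> n" for m n
    using that by (induction n rule: dec_induct) (auto intro: refines_refl refines_trans ref_Suc)
  define H where "H = (\<Union>n. S n)"
  \<comment> \<open>This covers stages before the pair is added: at a later stage \<open>k\<close>
    containing it the colours agree, and the common map \<open>\<rho>\<close> carries this back to
    stage \<open>n\<close>.\<close>
  have same: "c n ` feet x = c' n ` feet y" if "(x, y) \<in> H" for n x y
  proof -
    from that obtain m where "(x, y) \<in> S m" by (auto simp: H_def)
    define k where "k = max m n"
    have "(x, y) \<in> S k" using \<open>(x, y) \<in> S m\<close> S_mono[of m k] by (auto simp: k_def)
    with st have eq: "c k ` feet x = c' k ` feet y" by (rule stage_colours)
    have "refines (c n) (c' n) (c k) (c' k)" by (rule ref) (simp add: k_def)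
    then obtain \<rho> where \<rho>: "c n = \<rho> \<circ> c k" "c' n = \<rho> \<circ> c' k" unfolding refines_def by blast
    show ?thesis unfolding \<rho> image_comp[symmetric] eq ..
  qed
  have H_carrier: "x \<in> bing_carrier" "y \<in> bing_carrier" if "(x, y) \<in> H" for x y
  proof -
    from that obtain n where n: "(x, y) \<in> S n" by (auto simp: H_def)
    have "Domain (S n) \<subseteq> bing_carrier" "Range (S n) \<subseteq> bing_carrier"
      using st[of n] by (simp_all add: stage_def thin_def)
    with n show "x \<in> bing_carrier" "y \<in> bing_carrier" by blast+
  qed
  have sv: "single_valued (S n)" "single_valued ((S n)\<inverse>)" for n
    using st[of n] by (simp_all add: stage_def)
  have H_sv: "y = y'" if "(x, y) \<in> H" "(x, y') \<in> H" for x y y'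
  proof -
    from that obtain m n where "(x, y) \<in> S m" "(x, y') \<in> S n" by (auto simp: H_def)
    then have "(x, y) \<in> S (max m n)" "(x, y') \<in> S (max m n)"
      using S_mono[of m "max m n"] S_mono[of n "max m n"] by auto
    then show ?thesis using sv[of "max m n"] by (meson converse_iff single_valuedD)
  qed
  have H_inj: "x = x'" if "(x, y) \<in> H" "(x', y) \<in> H" for x x' y
  proof -
    from that obtain m n where "(x, y) \<in> S m" "(x', y) \<in> S n" by (auto simp: H_def)
    then have "(x, y) \<in> S (max m n)" "(x', y) \<in> S (max m n)"
      using S_mono[of m "max m n"] S_mono[of n "max m n"] by auto
    then show ?thesis using sv[of "max m n"] by (meson converse_iff single_valuedD)
  qed
  have H_axis: "snd x = 0 \<longleftrightarrow> snd y = 0" if "(x, y) \<in> H" "(x, y) \<notin> G" for x y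
    using that stage_axis[OF st] unfolding H_def by blast
  have fine: "\<exists>n y. (x, y) \<in> H \<and> fine_at \<delta> (c n) x \<and> fine_at \<delta> (c' n) y"
    and surj: "\<exists>y. (y, x) \<in> H" if x: "x \<in> bing_carrier" and \<delta>: "\<delta> > 0" for x and \<delta> :: real
  proof -
    obtain m where m: "inverse (real (Suc m)) < \<delta>" using reals_Archimedean[OF \<delta>] by blast
    have "(x, m) \<in> range task" using task x by auto
    then obtain n where n: "task n = (x, m)" by (metis imageE)
    have mono: "fine_at \<delta> d z" if "fine_at (inverse (real (Suc m))) d z" for d :: "real \<Rightarrow> nat" and z
      using that m unfolding fine_at_def by (meson less_trans)
    show "\<exists>n y. (x, y) \<in> H \<and> fine_at \<delta> (c n) x \<and> fine_at \<delta> (c' n) y"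
    proof -
      obtain y where "(x, y) \<in> S (Suc n)" "fine_at \<delta> (c (Suc n)) x" "fine_at \<delta> (c' (Suc n)) y"
        using fine_Suc[of n] mono unfolding n fst_conv snd_conv by blast
      then show ?thesis unfolding H_def by blast
    qed
    show "\<exists>y. (y, x) \<in> H" using ran[of n] unfolding n H_def by (simp add: Range_iff) blast
  qed
  define h where "h x = (THE y. (x, y) \<in> H)" for x
  define k where "k y = (THE x. (x, y) \<in> H)" for y
  have hI: "h x = y" and kI: "k y = x" if "(x, y) \<in> H" for x y
    unfolding h_def k_def using that by (auto intro!: the_equality dest: H_sv H_inj)
  have hH: "(x, h x) \<in> H" and kH: "(k x, x) \<in> H" if x: "x \<in> bing_carrier" for x
  proof -
    obtain y z where "(x, y) \<in> H" "(z, x) \<in> H"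
      using fine[OF x zero_less_one] surj[OF x zero_less_one] by blast
    with hI[of x y] kI[of z x] show "(x, h x) \<in> H" "(k x, x) \<in> H" by simp_all
  qed
  have lc: "locally_constant (c n)" "locally_constant (c' n)" for n
    using st[of n] by (simp_all add: stage_def)
  have "continuous_map bing_space bing_space h"
  proof (rule continuous_map_bing[OF _ B])
    show "h x \<in> bing_carrier" if "x \<in> bing_carrier" for x using hH[OF that] H_carrier by blast
    \<comment> \<open>A pair that breaks the axis condition belongs to \<open>G\<close>, so its
      second component is in \<open>B\<close>.\<close>
    show "snd (h (t, 0)) = 0 \<or> h (t, 0) \<in> B" for t
      using H_axis[OF hH[OF axis_in_carrier], of t] RG by auto
    show "\<exists>c c'. locally_constant c \<and> (\<forall>y\<in>bing_carrier. c ` feet y = c' ` feet (h y)) \<and>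
        fine_at \<delta> (c' :: real \<Rightarrow> nat) (h x)" if x: "x \<in> bing_carrier" "\<delta> > 0" for x \<delta>
    proof -
      obtain n y where "(x, y) \<in> H" "fine_at \<delta> (c' n) y" using fine[OF x] by blast
      then have "fine_at \<delta> (c' n) (h x)" using hI by simp
      then show ?thesis using same[OF hH] lc(1)[of n] by blast
    qed
  qed
  moreover have "continuous_map bing_space bing_space k"
  proof (rule continuous_map_bing[OF _ A])
    show "k x \<in> bing_carrier" if "x \<in> bing_carrier" for x using kH[OF that] H_carrier by blast
    show "snd (k (t, 0)) = 0 \<or> k (t, 0) \<in> A" for t
      using H_axis[OF kH[OF axis_in_carrier], of t] DG by auto
    show "\<exists>c c'. locally_constant c \<and> (\<forall>y\<in>bing_carrier. c ` feet y = c' ` feet (k y)) \<and>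
        fine_at \<delta> (c' :: real \<Rightarrow> nat) (k x)" if x: "x \<in> bing_carrier" "\<delta> > 0" for x \<delta>
    proof -
      have "k x \<in> bing_carrier" using kH[OF x(1)] H_carrier by blast
      \<comment> \<open>The inverse swaps the two colourings, so fineness is needed for
        \<open>c n\<close> at \<open>k x\<close>, a point of the domain side.\<close>
      then obtain n where "fine_at \<delta> (c n) (k x)" using fine[OF _ x(2)] by blast
      then show ?thesis using same[OF kH, symmetric] lc(2)[of n] by blast
    qed
  qed
  ultimately have "homeomorphic_maps bing_space bing_space h k"
    unfolding homeomorphic_maps_def topspace_bing_space using kI[OF hH] hI[OF kH] by simp
  moreover have "h a = f a" if "a \<in> A" for a
    using that S0 by (intro hI) (auto simp: H_def G_def)
  ultimately show ?thesis using homeomorphic_maps_imp_map by blast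
qed

end
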